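(* Let $K\in\{1,2,\ldots,M-1\}$, and for a graph signal $\mathbf{x}\in\mathbb{R}^V$ define its low frequency component with bandwidth $K$ by $\mathbf{x}_K=\sum_{m=1}^{K}\widehat{\mathbf{x}}(m)$. Then $$\|\mathbf{x}-\mathbf{x}_K\|_2\le \frac{\big(\sum_{l=1}^d\|\mathbf{S}_l\mathbf{x}\|_2^2\big)^{1/2}}{\|\boldsymbol{\gamma}(K+1)\|}.$$
   Context: Let $\mathcal{G}=(V,E,\mathbf{W})$ be a finite, simple, undirected graph with $N\ge 2$ vertices. A graph signal is a vector $\mathbf{x}\in\mathbb{R}^V$, with Euclidean norm $\|\mathbf{x}\|_2$. A graph shift is a matrix $\mathbf{S}=[s(i,j)]_{i,j\in V}$ with $s(i,j)=0$ unless $i=j$ or $(i,j)\in E$. Standing assumption: $\mathbf{S}_1,\ldots,\mathbf{S}_d$ are graph shifts that are real-valued, symmetric and pairwise commuting. Choose an orthogonal matrix $\mathbf{U}=[\mathbf{u}_1,\ldots,\mathbf{u}_N]$ with $\mathbf{S}_l=\sum_{n=1}^N\lambda_l(n)\mathbf{u}_n\mathbf{u}_n^T$ for $1\le l\le d$, and set $\boldsymbol{\lambda}(n)=[\lambda_1(n),\ldots,\lambda_d(n)]^T\in\mathbb{R}^d$. Let $\boldsymbol{\gamma}(m)=[\gamma_1(m),\ldots,\gamma_d(m)]^T$, $1\le m\le M$, be the distinct elements of $\{\boldsymbol{\lambda}(n): 1\le n\le N\}$, ordered so that $\|\boldsymbol{\gamma}(1)\|\le\|\boldsymbol{\gamma}(2)\|\le\cdots\le\|\boldsymbol{\gamma}(M)\|$,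 where $\|\cdot\|$ is the Euclidean norm on $\mathbb{R}^d$. Put $\mathbf{P}_m=\sum_{\boldsymbol{\lambda}(n)=\boldsymbol{\gamma}(m)}\mathbf{u}_n\mathbf{u}_n^T$ (the orthogonal projection onto $\bigcap_{l=1}^d\ker(\mathbf{S}_l-\gamma_l(m)\mathbf{I})$, independent of the choice of $\mathbf{U}$). The graph Fourier transform of $\mathbf{x}$ has components $\widehat{\mathbf{x}}(m)=\mathbf{P}_m\mathbf{x}$, $1\le m\le M$. *)

theory Defs
  imports "HOL-Analysis.Analysis"
begin

text \<open>
  The vertex set is the finite type \<open>'v\<close>, so a graph signal is a vector of type \<open>real^'v\<close>. The
  weights carry no condition, and graph shifts depend only on the edges.
\<close>

record 'v weighted_graph =
  edges :: "('v \<times> 'v) set"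
  weights :: "real^'v^'v"

definition simple_undirected :: "('v::finite) weighted_graph \<Rightarrow> bool" where
  "simple_undirected G \<longleftrightarrow> irrefl (edges G) \<and> sym (edges G)"

definition graph_shift :: "('v::finite) weighted_graph \<Rightarrow> real^'v^'v \<Rightarrow> bool" where
  "graph_shift G S \<longleftrightarrow> (\<forall>i j. S $ i $ j \<noteq> 0 \<longrightarrow> i = j \<or> (i, j) \<in> edges G)"

definition outer :: "real^'v \<Rightarrow> real^'v^('v::finite)" where
  "outer u = (columnvector u :: real^1^'v) ** (rowvector u :: real^'v^1)"

text \<open>
  The columns of the orthogonal matrix \<open>U\<close> and the joint eigenvalues are labelled by \<open>'v\<close>
  instead of by the numbers from 1 to \<open>CARD('v)\<close>; the labelling is immaterial. The vector
  \<open>lam n\<close> lists the eigenvalues of all shifts on column \<open>n\<close>.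
\<close>

definition joint_diagonalization ::
    "('d::finite \<Rightarrow> real^'v^'v) \<Rightarrow> real^'v^('v::finite) \<Rightarrow> ('v \<Rightarrow> real^'d) \<Rightarrow> bool" where
  "joint_diagonalization S U lam \<longleftrightarrow>
     orthogonal_matrix U \<and>
     (\<forall>l. S l = (\<Sum>n\<in>UNIV. (lam n $ l) *\<^sub>R outer (column n U)))"

definition frequency_enumeration ::
    "('v::finite \<Rightarrow> real^('d::finite)) \<Rightarrow> nat \<Rightarrow> (nat \<Rightarrow> real^'d) \<Rightarrow> bool" where
  "frequency_enumeration lam M gam \<longleftrightarrow>
     bij_betw gam {1..M} (range lam) \<and> mono_on {1..M} (\<lambda>m. norm (gam m))"

definition spectral_projection ::
    "real^'v^('v::finite) \<Rightarrow> ('v \<Rightarrow> real^('d::finite)) \<Rightarrow> (nat \<Rightarrow> real^'d) \<Rightarrow> nat \<Rightarrow> real^'v^'v" where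
  "spectral_projection U lam gam m = (\<Sum>n | lam n = gam m. outer (column n U))"

definition graph_fourier ::
    "real^'v^('v::finite) \<Rightarrow> ('v \<Rightarrow> real^('d::finite)) \<Rightarrow> (nat \<Rightarrow> real^'d) \<Rightarrow> real^'v \<Rightarrow> nat \<Rightarrow> real^'v"
  where
  "graph_fourier U lam gam x m = spectral_projection U lam gam m *v x"

definition low_frequency ::
    "real^'v^('v::finite) \<Rightarrow> ('v \<Rightarrow> real^('d::finite)) \<Rightarrow> (nat \<Rightarrow> real^'d) \<Rightarrow> nat \<Rightarrow> real^'v \<Rightarrow> real^'v"
  where
  "low_frequency U lam gam K x = (\<Sum>m=1..K. graph_fourier U lam gam x m)"

end

theory Submission
  imports Defs
begin

text \<open>
  Expand \<open>x\<close> in the orthonormal basis of columns of \<open>U\<close>. The squared norms of the \<open>S l *v x\<close>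
  add up to the sum of the squared coefficients of \<open>x\<close> weighted by \<open>(norm (lam n))\<^sup>2\<close>,
  while \<open>x - low_frequency U lam gam K x\<close> retains exactly the coefficients with
  \<open>lam n = gam m\<close> for some \<open>m > K\<close>, where the weight is at least \<open>(norm (gam (K + 1)))\<^sup>2\<close>.
\<close>

lemma outer_mult_vector: "outer u *v x = (u \<bullet> x) *\<^sub>R u"
  by (simp add: outer_def vec_eq_iff matrix_vector_mult_def matrix_matrix_mult_def
      columnvector_def rowvector_def inner_vec_def sum_distrib_right sum_distrib_left ac_simps)

lemma sum_matrix_vector_mult:
  fixes A :: "'a \<Rightarrow> real^'n^'m"
  shows "(\<Sum>i\<in>I. A i) *v x = (\<Sum>i\<in>I. A i *v x)"
  by (induction I rule: infinite_finite_induct) (auto simp: matrix_vector_mult_add_rdistrib)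

text \<open>Orthogonality gives \<open>U ** transpose U = mat 1\<close>, so \<open>x\<close> is
  \<open>U\<close> applied to \<open>transpose U *v x\<close>, whose entries are the inner products
  of \<open>x\<close> with the columns.\<close>

lemma orthonormal_expansion:
  fixes U :: "real^'n^'n"
  assumes "orthogonal_matrix U"
  shows "x = (\<Sum>n\<in>UNIV. (column n U \<bullet> x) *\<^sub>R column n U)"
proof -
  have coeff: "(transpose U *v x) $ n = column n U \<bullet> x" for n
    by (simp add: matrix_vector_mult_def column_def transpose_def inner_vec_def
        del: transpose_matrix_vector)
  have "x = U *v (transpose U *v x)"
    using assms by (simp add: orthogonal_matrix_def matrix_vector_mul_assoc
        del: transpose_matrix_vector)
  also have "\<dots> = (\<Sum>n\<in>UNIV. (column n U \<bullet> x) *\<^sub>R column n U)"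
    by (simp add: matrix_mult_sum[of U] scalar_mult_eq_scaleR coeff
        del: transpose_matrix_vector)
  finally show ?thesis .
qed

lemma norm_power2_vec:
  fixes v :: "real^'n"
  shows "(norm v)\<^sup>2 = (\<Sum>i\<in>UNIV. (v $ i)\<^sup>2)"
  by (simp add: norm_vec_def L2_set_def sum_nonneg)

text \<open>Parseval: the combination is \<open>U\<close> applied to the coefficient vector, and an
  orthogonal matrix preserves the norm.\<close>

lemma norm_sum_columns:
  fixes U :: "real^'n^'n"
  assumes "orthogonal_matrix U"
  shows "(norm (\<Sum>n\<in>UNIV. c n *\<^sub>R column n U))\<^sup>2 = (\<Sum>n\<in>UNIV. (c n)\<^sup>2)"
proof -
  have "(\<Sum>n\<in>UNIV. c n *\<^sub>R column n U) = U *v (\<chi> n. c n)"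
    by (simp add: matrix_mult_sum scalar_mult_eq_scaleR)
  moreover have "norm (U *v (\<chi> n. c n)) = norm (\<chi> n. c n)"
    using assms orthogonal_transformation_matrix[of "(*v) U"]
    by (simp add: orthogonal_transformation_norm)
  ultimately show ?thesis
    by (simp add: norm_power2_vec)
qed

text \<open>Each \<open>S l\<close> multiplies the coefficient along column \<open>n\<close> by
  \<open>lam n $ l\<close>. Parseval for every \<open>l\<close>, followed by an exchange of sums,
  collects the squared eigenvalues over \<open>l\<close> into the squared norm of the vector
  \<open>lam n\<close>.\<close>

lemma sum_norm_shifts:
  assumes "joint_diagonalization S U lam"
  shows "(\<Sum>l\<in>UNIV. (norm (S l *v x))\<^sup>2)
           = (\<Sum>n\<in>UNIV. (norm (lam n))\<^sup>2 * (column n U \<bullet> x)\<^sup>2)"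
proof -
  have U: "orthogonal_matrix U"
    and S: "S l = (\<Sum>n\<in>UNIV. (lam n $ l) *\<^sub>R outer (column n U))" for l
    using assms by (auto simp: joint_diagonalization_def)
  have "S l *v x = (\<Sum>n\<in>UNIV. (lam n $ l * (column n U \<bullet> x)) *\<^sub>R column n U)" for l
    by (simp add: S sum_matrix_vector_mult scaleR_matrix_vector_assoc[symmetric] outer_mult_vector)
  then have "(\<Sum>l\<in>UNIV. (norm (S l *v x))\<^sup>2)
      = (\<Sum>l\<in>UNIV. \<Sum>n\<in>UNIV. (lam n $ l)\<^sup>2 * (column n U \<bullet> x)\<^sup>2)"
    by (simp add: norm_sum_columns[OF U] power_mult_distrib)
  also have "\<dots> = (\<Sum>n\<in>UNIV. \<Sum>l\<in>UNIV. (lam n $ l)\<^sup>2 * (column n U \<bullet> x)\<^sup>2)"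
    by (rule sum.swap)
  also have "\<dots> = (\<Sum>n\<in>UNIV. (norm (lam n))\<^sup>2 * (column n U \<bullet> x)\<^sup>2)"
    by (simp add: norm_power2_vec sum_distrib_right)
  finally show ?thesis .
qed

text \<open>Injectivity of \<open>gam\<close> makes the column groups of different frequencies
  disjoint, so no column is counted twice when the projections are added.\<close>

lemma low_frequency_expansion:
  assumes "inj_on gam {1..K}"
  shows "low_frequency U lam gam K x
           = (\<Sum>n\<in>{n. lam n \<in> gam ` {1..K}}. (column n U \<bullet> x) *\<^sub>R column n U)"
proof -
  let ?f = "\<lambda>n. (column n U \<bullet> x) *\<^sub>R column n U"
  have "low_frequency U lam gam K x = (\<Sum>m=1..K. sum ?f {n. lam n = gam m})"
    by (simp add: low_frequency_def graph_fourier_def spectral_projection_def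
        sum_matrix_vector_mult outer_mult_vector)
  also have "\<dots> = sum ?f (\<Union>m\<in>{1..K}. {n. lam n = gam m})"
  proof (rule sum.UNION_disjoint[symmetric])
    show "\<forall>m\<in>{1..K}. \<forall>m'\<in>{1..K}. m \<noteq> m' \<longrightarrow> {n. lam n = gam m} \<inter> {n. lam n = gam m'} = {}"
      using inj_onD[OF assms] by fastforce
  qed simp_all
  also have "(\<Union>m\<in>{1..K}. {n. lam n = gam m}) = {n. lam n \<in> gam ` {1..K}}"
    by auto
  finally show ?thesis .
qed

lemma norm_high_frequency:
  assumes U: "orthogonal_matrix U" and "inj_on gam {1..K}"
  shows "(norm (x - low_frequency U lam gam K x))\<^sup>2
           = (\<Sum>n\<in>{n. lam n \<notin> gam ` {1..K}}. (column n U \<bullet> x)\<^sup>2)"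
proof -
  define L where "L = {n. lam n \<in> gam ` {1..K}}"
  \<comment> \<open>Padding with zeros on \<open>L\<close> turns the remainder into a combination of
    all columns, the form to which Parseval applies.\<close>
  let ?c = "\<lambda>n. if n \<in> L then 0 else column n U \<bullet> x"
  have "x - low_frequency U lam gam K x
      = (\<Sum>n\<in>UNIV. (column n U \<bullet> x) *\<^sub>R column n U)
        - (\<Sum>n\<in>L. (column n U \<bullet> x) *\<^sub>R column n U)"
    using orthonormal_expansion[OF U, of x] low_frequency_expansion[OF assms(2), of U lam x]
    by (simp add: L_def)
  also have "\<dots> = (\<Sum>n\<in>- L. (column n U \<bullet> x) *\<^sub>R column n U)"
    by (simp add: sum_diff Compl_eq_Diff_UNIV)
  also have "\<dots> = (\<Sum>n\<in>UNIV. ?c n *\<^sub>R column n U)"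
    by (rule sum.mono_neutral_cong_left) auto
  finally have "(norm (x - low_frequency U lam gam K x))\<^sup>2 = (\<Sum>n\<in>UNIV. (?c n)\<^sup>2)"
    by (simp only: norm_sum_columns[OF U])
  also have "\<dots> = (\<Sum>n\<in>- L. (column n U \<bullet> x)\<^sup>2)"
    by (rule sum.mono_neutral_cong_right) auto
  also have "- L = {n. lam n \<notin> gam ` {1..K}}"
    by (auto simp: L_def)
  finally show ?thesis .
qed

theorem theorem2p4:
  fixes G :: "('v::finite) weighted_graph"
    and S :: "'d::finite \<Rightarrow> real^'v^'v"
    and U :: "real^'v^'v"
    and lam :: "'v \<Rightarrow> real^'d"
    and gam :: "nat \<Rightarrow> real^'d"
    and M K :: nat
    and x :: "real^'v"
  assumes "CARD('v) \<ge> 2"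
    and "simple_undirected G"
    and "\<And>l. graph_shift G (S l)"
    and "\<And>l. transpose (S l) = S l"
    and "\<And>l l'. S l ** S l' = S l' ** S l"
    and "joint_diagonalization S U lam"
    and "frequency_enumeration lam M gam"
    and "K \<in> {1..M - 1}"
  shows "norm (x - low_frequency U lam gam K x)
           \<le> sqrt (\<Sum>l\<in>UNIV. (norm (S l *v x))\<^sup>2) / norm (gam (K + 1))"
proof -
  define g where "g = norm (gam (K + 1))"
  have U: "orthogonal_matrix U"
    using assms(6) by (simp add: joint_diagonalization_def)
  have K: "1 \<le> K" "K + 1 \<le> M"
    using assms(8) by auto
  have inj: "inj_on gam {1..M}" and range: "gam ` {1..M} = range lam"
    and mono: "\<And>i j. i \<in> {1..M} \<Longrightarrow> j \<in> {1..M} \<Longrightarrow> i \<le> j \<Longrightarrow> norm (gam i) \<le> norm (gam j)"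
    using assms(7) by (auto simp: frequency_enumeration_def bij_betw_def mono_on_def)
  have injK: "inj_on gam {1..K}"
    using inj by (rule inj_on_subset) (use K in auto)
  \<comment> \<open>\<open>gam (K + 1) = 0\<close> would force \<open>gam 1 = 0\<close>, against injectivity.\<close>
  have "gam (K + 1) \<noteq> 0"
  proof
    assume 0: "gam (K + 1) = 0"
    with mono[of 1 "K + 1"] K have "gam 1 = gam (K + 1)"
      by simp
    with inj_onD[OF inj, of 1 "K + 1"] K show False
      by simp
  qed
  then have "g > 0"
    by (simp add: g_def)
  \<comment> \<open>Every \<open>lam n\<close> is listed as some \<open>gam m\<close>; outside the
    first \<open>K\<close> entries this means \<open>m\<close> is at least \<open>K + 1\<close>, and
    the norms increase along the list.\<close>
  have high: "g \<le> norm (lam n)" if n: "lam n \<notin> gam ` {1..K}" for n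
  proof -
    obtain m where m: "m \<in> {1..M}" "lam n = gam m"
      using range by (metis imageE rangeI)
    with n have "K + 1 \<le> m"
      by (force simp: not_le)
    with m K mono[of "K + 1" m] show ?thesis
      by (simp add: g_def)
  qed
  have "(g * norm (x - low_frequency U lam gam K x))\<^sup>2
      = (\<Sum>n\<in>{n. lam n \<notin> gam ` {1..K}}. g\<^sup>2 * (column n U \<bullet> x)\<^sup>2)"
    by (simp add: power_mult_distrib norm_high_frequency[OF U injK] sum_distrib_left)
  also have "\<dots> \<le> (\<Sum>n\<in>{n. lam n \<notin> gam ` {1..K}}. (norm (lam n))\<^sup>2 * (column n U \<bullet> x)\<^sup>2)"
    using high \<open>g > 0\<close> by (intro sum_mono mult_right_mono power_mono) auto
  \<comment> \<open>The low frequency terms are put back; they are nonnegative, and the full sum is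
    the shift energy.\<close>
  also have "\<dots> \<le> (\<Sum>n\<in>UNIV. (norm (lam n))\<^sup>2 * (column n U \<bullet> x)\<^sup>2)"
    by (rule sum_mono2) auto
  also have "\<dots> = (\<Sum>l\<in>UNIV. (norm (S l *v x))\<^sup>2)"
    by (rule sum_norm_shifts[OF assms(6), symmetric])
  finally have "g * norm (x - low_frequency U lam gam K x)
      \<le> sqrt (\<Sum>l\<in>UNIV. (norm (S l *v x))\<^sup>2)"
    by (rule real_le_rsqrt)
  with \<open>g > 0\<close> show ?thesis
    unfolding g_def[symmetric] by (simp add: pos_le_divide_eq mult.commute)
qed

end
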